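(* Let $J$ be any constant antisymmetric real $m\times m$ matrix (not necessarily invertible) and let $H\colon\mathbb{R}^m\to\mathbb{R}$ be smooth. Let real coefficients $a_{ij}, b_i$ ($1\le i,j\le s$) be those of a symplectic $s$-stage Runge--Kutta method, i.e. $b_ib_j-b_ja_{ji}-b_ia_{ij}=0$ for all $i,j$. Then any solutions of this Runge--Kutta method applied, with time step $\Delta t$, to the generalized Hamiltonian system $J\dot z=\nabla H(z)$, $z\in\mathbb{R}^m$, preserve the 2-form $\frac12 dz\wedge J\,dz$; that is, $\frac12 dz_1\wedge J\,dz_1=\frac12 dz_0\wedge J\,dz_0$.
   Context: Notation: $dz\wedge J\,dz:=\sum_{i,j=1}^m J_{ij}\,dz_i\wedge dz_j$. The Runge--Kutta method applied to $J\dot z=\nabla H(z)$ is the relation between $z_0\in\mathbb{R}^m$ and $z_1\in\mathbb{R}^m$ given by the equations, with stages $Z_i,F_i\in\mathbb{R}^m$, $i=1,\dots,s$, $$JZ_i=Jz_0+\Delta t\sum_{j=1}^s a_{ij}JF_j,\qquad Jz_1=Jz_0+\Delta t\sum_{j=1}^s b_jJF_j,\qquad JF_j=\nabla H(Z_j).$$ A solution of the method is a tuple $(z_0,Z_1,\dots,Z_s,F_1,\dots,F_s,z_1)$ satisfying these equations. Existence or uniqueness of solutions is not asserted. "Solutions preserve the 2-form" means: for any smooth family of solutions $(z_0,Z_i,F_i,z_1)$ parametrized by a smooth manifold $N$ (so that $z_0,z_1,Z_i,F_i\colon N\to\mathbb{R}^m$ are smooth and satisfy the equations identically), the pullbacks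 of the 2-form $\frac12 dz\wedge J\,dz$ to $N$ by $z_0$ and by $z_1$ are equal. *)

theory Defs
  imports "HOL-Analysis.Analysis"
begin

section \<open>Smooth maps and smooth manifolds\<close>

text \<open>
  The two definitions below are meant for open S and finite-dimensional 'a, where they say that
  all iterated directional derivatives up to order k (of every order) exist and are continuous,
  each map so obtained being Frechet differentiable if its order is below k.
\<close>

primrec times_differentiable_on ::
    "nat \<Rightarrow> 'a::real_normed_vector set \<Rightarrow> ('a \<Rightarrow> 'b::real_normed_vector) \<Rightarrow> bool" where
  "times_differentiable_on 0 S f \<longleftrightarrow> continuous_on S f"
| "times_differentiable_on (Suc k) S f \<longleftrightarrow>
     (\<forall>x\<in>S. f differentiable (at x)) \<and>
     (\<forall>v. times_differentiable_on k S (\<lambda>x. frechet_derivative f (at x) v))"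

definition smooth_on :: "'a::real_normed_vector set \<Rightarrow> ('a \<Rightarrow> 'b::real_normed_vector) \<Rightarrow> bool" where
  "smooth_on S f \<longleftrightarrow> (\<forall>k. times_differentiable_on k S f)"

text \<open>A chart is a pair of its domain and its coordinate map; the latter is irrelevant
  outside the domain.\<close>

type_synonym ('p, 'e) chart = "'p set \<times> ('p \<Rightarrow> 'e)"

definition chart_inv :: "('p, 'e) chart \<Rightarrow> 'e \<Rightarrow> 'p" where
  "chart_inv c = the_inv_into (fst c) (snd c)"

definition is_chart :: "'p topology \<Rightarrow> ('p, 'e::real_normed_vector) chart \<Rightarrow> bool" where
  "is_chart N c \<longleftrightarrow>
     openin N (fst c) \<and> open (snd c ` fst c) \<and>
     homeomorphic_map (subtopology N (fst c)) (top_of_set (snd c ` fst c)) (snd c)"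

text \<open>The model space 'e is any finite-dimensional normed space. The class euclidean_space would
  force the dimension to be positive and so exclude discrete manifolds.\<close>

definition smooth_manifold ::
    "'p topology \<Rightarrow> ('p, 'e::real_normed_vector) chart set \<Rightarrow> bool" where
  "smooth_manifold N A \<longleftrightarrow>
     (\<exists>B :: 'e set. finite B \<and> span B = UNIV) \<and>
     Hausdorff_space N \<and> second_countable N \<and>
     (\<forall>c\<in>A. is_chart N c) \<and>
     (\<Union>c\<in>A. fst c) = topspace N \<and>
     (\<forall>c\<in>A. \<forall>d\<in>A. smooth_on (snd c ` (fst c \<inter> fst d)) (snd d \<circ> chart_inv c))"

definition smooth_map ::
    "('p, 'e::real_normed_vector) chart set \<Rightarrow> ('p \<Rightarrow> 'b::real_normed_vector) \<Rightarrow> bool" where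
  "smooth_map A f \<longleftrightarrow> (\<forall>c\<in>A. smooth_on (snd c ` fst c) (f \<circ> chart_inv c))"

text \<open>A tangent vector at p assigns to every chart around p a vector of the model space, such that
  the vectors of two charts correspond under the derivative of the transition map. The value 0
  at the other charts is a convention that makes the assignment unique.\<close>

definition tangent_space ::
    "('p, 'e::real_normed_vector) chart set \<Rightarrow> 'p \<Rightarrow> (('p, 'e) chart \<Rightarrow> 'e) set" where
  "tangent_space A p =
     {X. (\<forall>c. \<not> (c \<in> A \<and> p \<in> fst c) \<longrightarrow> X c = 0) \<and>
         (\<forall>c\<in>A. \<forall>d\<in>A. p \<in> fst c \<and> p \<in> fst d \<longrightarrow>
            X d = frechet_derivative (snd d \<circ> chart_inv c) (at (snd c p)) (X c))}"

text \<open>The choice of the chart does not matter for smooth f, see differential_eq below.\<close>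

definition differential ::
    "('p, 'e::real_normed_vector) chart set \<Rightarrow> ('p \<Rightarrow> 'b::real_normed_vector) \<Rightarrow> 'p \<Rightarrow>
       (('p, 'e) chart \<Rightarrow> 'e) \<Rightarrow> 'b" where
  "differential A f p X =
     (let c = (SOME c. c \<in> A \<and> p \<in> fst c)
      in frechet_derivative (f \<circ> chart_inv c) (at (snd c p)) (X c))"

lemma differential_eq:
  assumes N: "smooth_manifold N A" and f: "smooth_map A f"
    and X: "X \<in> tangent_space A p" and c: "c \<in> A" "p \<in> fst c"
  shows "differential A f p X = frechet_derivative (f \<circ> chart_inv c) (at (snd c p)) (X c)"
proof -
  define d where "d = (SOME c. c \<in> A \<and> p \<in> fst c)"
  have d: "d \<in> A" "p \<in> fst d"
    using someI[of "\<lambda>c. c \<in> A \<and> p \<in> fst c" c] c unfolding d_def by auto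
  have diffb: "g differentiable (at x)" if "smooth_on S g" "x \<in> S"
    for S x and g :: "'b \<Rightarrow> 'd::real_normed_vector"
    using that unfolding smooth_on_def by (metis times_differentiable_on.simps(2))
  have chart: "is_chart N c" "is_chart N d"
    using N c d unfolding smooth_manifold_def by auto
  have sub: "fst c \<subseteq> topspace N" "fst d \<subseteq> topspace N"
    using chart unfolding is_chart_def by (auto dest: openin_subset)
  have inj: "inj_on (snd c) (fst c)" "inj_on (snd d) (fst d)"
    using chart sub unfolding is_chart_def homeomorphic_eq_everything_map
    by (auto simp: topspace_subtopology Int_absorb1)
  have inv: "chart_inv c (snd c q) = q" if "q \<in> fst c" for q
    unfolding chart_inv_def using inj that by (simp add: the_inv_into_f_f)
  have invd: "chart_inv d (snd d q) = q" if "q \<in> fst d" for q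
    unfolding chart_inv_def using inj that by (simp add: the_inv_into_f_f)
  define S where "S = snd c ` (fst c \<inter> fst d)"
  have xS: "snd c p \<in> S" using c d unfolding S_def by auto
  have "openin (subtopology N (fst c)) (fst c \<inter> fst d)"
    using chart unfolding is_chart_def by (metis inf_commute openin_subtopology_Int2 openin_subtopology_Int)
  then have "openin (top_of_set (snd c ` fst c)) S"
    using chart unfolding is_chart_def S_def
    by (metis homeomorphic_imp_open_map open_map_def)
  then have "open S"
    using chart unfolding is_chart_def by (meson openin_open_trans)
  have 1: "(snd d \<circ> chart_inv c) differentiable (at (snd c p))"
    using N c d xS diffb unfolding smooth_manifold_def S_def by blast
  have e: "(snd d \<circ> chart_inv c) (snd c p) = snd d p" using inv c by simp
  have 2: "(f \<circ> chart_inv d) differentiable (at ((snd d \<circ> chart_inv c) (snd c p)))"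
    using f d diffb e unfolding smooth_map_def by (metis imageI)
  have "((f \<circ> chart_inv d) \<circ> (snd d \<circ> chart_inv c) has_derivative
      frechet_derivative (f \<circ> chart_inv d) (at (snd d p)) \<circ>
      frechet_derivative (snd d \<circ> chart_inv c) (at (snd c p))) (at (snd c p))"
    using diff_chain_at 1 2 e unfolding frechet_derivative_works by metis
  then have "(f \<circ> chart_inv c has_derivative
      frechet_derivative (f \<circ> chart_inv d) (at (snd d p)) \<circ>
      frechet_derivative (snd d \<circ> chart_inv c) (at (snd c p))) (at (snd c p))"
    by (rule has_derivative_transform_within_open[OF _ \<open>open S\<close> xS])
       (auto simp: S_def inv invd)
  then have "frechet_derivative (f \<circ> chart_inv c) (at (snd c p)) =
      frechet_derivative (f \<circ> chart_inv d) (at (snd d p)) \<circ>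
      frechet_derivative (snd d \<circ> chart_inv c) (at (snd c p))"
    by (metis frechet_derivative_at)
  moreover have "X d = frechet_derivative (snd d \<circ> chart_inv c) (at (snd c p)) (X c)"
    using X c d unfolding tangent_space_def by blast
  ultimately show ?thesis
    unfolding differential_def d_def[symmetric] Let_def by simp
qed

section \<open>Differential forms on coordinate space and their pullbacks\<close>

type_synonym 'm one_form = "real^'m \<Rightarrow> real^'m \<Rightarrow> real"
type_synonym 'm two_form = "real^'m \<Rightarrow> real^'m \<Rightarrow> real^'m \<Rightarrow> real"

text \<open>The first argument of a form is the base point, the others are tangent vectors.\<close>

definition dz :: "'m::finite \<Rightarrow> 'm one_form" where
  "dz i z u = u $ i"

definition wedge :: "'m::finite one_form \<Rightarrow> 'm one_form \<Rightarrow> 'm two_form" where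
  "wedge \<alpha> \<beta> z u v = \<alpha> z u * \<beta> z v - \<alpha> z v * \<beta> z u"

definition dz_wedge_J_dz :: "real^'m::finite^'m \<Rightarrow> 'm two_form" where
  "dz_wedge_J_dz J z u v = (\<Sum>i\<in>UNIV. \<Sum>j\<in>UNIV. J $ i $ j * wedge (dz i) (dz j) z u v)"

definition pullback ::
    "('p, 'e::real_normed_vector) chart set \<Rightarrow> ('p \<Rightarrow> real^'m::finite) \<Rightarrow> 'm two_form \<Rightarrow>
       'p \<Rightarrow> (('p, 'e) chart \<Rightarrow> 'e) \<Rightarrow> (('p, 'e) chart \<Rightarrow> 'e) \<Rightarrow> real" where
  "pullback A f \<omega> p X Y = \<omega> (f p) (differential A f p X) (differential A f p Y)"

section \<open>Runge--Kutta methods for generalized Hamiltonian systems\<close>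

definition symplectic_RK :: "real^'s::finite^'s \<Rightarrow> real^'s \<Rightarrow> bool" where
  "symplectic_RK a b \<longleftrightarrow>
     (\<forall>i j. b $ i * b $ j - b $ j * a $ j $ i - b $ i * a $ i $ j = 0)"

text \<open>The equation J F_j = grad H (Z_j) is written with the library's gradient predicate GDERIV.\<close>

definition RK_solution ::
    "real^'m::finite^'m \<Rightarrow> (real^'m \<Rightarrow> real) \<Rightarrow> real^'s::finite^'s \<Rightarrow> real^'s \<Rightarrow> real \<Rightarrow>
       real^'m \<Rightarrow> ('s \<Rightarrow> real^'m) \<Rightarrow> ('s \<Rightarrow> real^'m) \<Rightarrow> real^'m \<Rightarrow> bool" where
  "RK_solution J H a b dt z0 Z F z1 \<longleftrightarrow>
     (\<forall>i. J *v Z i = J *v z0 + dt *\<^sub>R (\<Sum>j\<in>UNIV. a $ i $ j *\<^sub>R (J *v F j))) \<and>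
     J *v z1 = J *v z0 + dt *\<^sub>R (\<Sum>j\<in>UNIV. b $ j *\<^sub>R (J *v F j)) \<and>
     (\<forall>j. GDERIV H (Z j) :> (J *v F j))"

end

theory Submission
  imports Defs
begin

text \<open>
  Write \<open>\<omega> u v = u \<bullet> J v\<close>. This is the form \<open>1/2 dz \<and> J dz\<close>, because \<open>J\<close> is antisymmetric; it is
  antisymmetric, and it sees its arguments only modulo the kernel of \<open>J\<close>. The latter is why the
  argument for symplectic Runge--Kutta methods survives when \<open>J\<close> is singular: the linear
  equations of the method prescribe \<open>J z1\<close> and \<open>J (Z i)\<close> rather than \<open>z1\<close> and \<open>Z i\<close>, and this
  suffices for computing with \<open>\<omega>\<close>.

  Differentiating the equations of the method along a tangent vector of the parameter manifold
  gives their linearisation: the variations \<open>(u0, U, f, u1)\<close> satisfy the same linear relations,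
  and \<open>J f i\<close> is the Hessian of \<open>H\<close> at the stage \<open>Z i\<close> applied to \<open>U i\<close>. For a second tangent vector
  with variations \<open>(v0, V, g, v1)\<close>, symmetry of the Hessian says \<open>U i \<bullet> J (g i) = V i \<bullet> J (f i)\<close>,
  that is, \<open>\<omega> (U i) (g i) + \<omega> (f i) (V i) = 0\<close> (\<open>stage_variation_symmetric\<close>). Expanding
  \<open>\<omega> u1 v1\<close> and eliminating \<open>u0\<close>, \<open>v0\<close> from the terms linear in \<open>dt\<close> in favour of the stages leaves
  \<open>\<omega> u0 v0\<close>, a linear combination of these vanishing sums, and \<open>dt\<^sup>2\<close> times a double sum with the coefficients
  \<open>b i * b j - b j * a j i - b i * a i j\<close>, which are zero (\<open>symplectic_RK_preserves_form\<close>).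

  The symmetry of the Hessian is obtained from the mean value theorem, applied to second
  differences (\<open>second_derivative_symmetric\<close>).
\<close>

section \<open>Symmetry of second derivatives\<close>

text \<open>The left-hand side is symmetric in \<open>u\<close> and \<open>v\<close>, the right-hand side approximates a mixed
  derivative: this is the mean value theorem in direction \<open>u\<close> for
  \<open>y \<mapsto> f (y + h v) - f y\<close>, followed by the one in direction \<open>v\<close> for the derivative along \<open>u\<close>.\<close>

lemma second_difference_mean_value:
  fixes f :: "'a::real_normed_vector \<Rightarrow> real"
  assumes f: "\<And>y. (f has_derivative f' y) (at y)"
    and f': "\<And>y. ((\<lambda>y. f' y u) has_derivative f'' y) (at y)"
    and h: "h > 0"
  shows "\<exists>s t. 0 < s \<and> s < h \<and> 0 < t \<and> t < h \<and>
    f (x + h *\<^sub>R u + h *\<^sub>R v) - f (x + h *\<^sub>R u) - f (x + h *\<^sub>R v) + f x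
      = h\<^sup>2 * f'' (x + s *\<^sub>R u + t *\<^sub>R v) v"
proof -
  have df: "((\<lambda>s. f (y + s *\<^sub>R u)) has_real_derivative f' (y + s *\<^sub>R u) u) (at s)" for y s
  proof -
    have "((\<lambda>s. f (y + s *\<^sub>R u)) has_derivative (\<lambda>r. f' (y + s *\<^sub>R u) (r *\<^sub>R u))) (at s)"
      by (rule has_derivative_compose[OF _ f]) (auto intro!: derivative_eq_intros)
    then show ?thesis
      using linear_scale[OF has_derivative_linear[OF f]]
      by (simp add: has_field_derivative_def mult_commute_abs)
  qed
  have df': "((\<lambda>t. f' (y + t *\<^sub>R v) u) has_real_derivative f'' (y + t *\<^sub>R v) v) (at t)" for y t
  proof -
    have "((\<lambda>t. f' (y + t *\<^sub>R v) u) has_derivative (\<lambda>r. f'' (y + t *\<^sub>R v) (r *\<^sub>R v))) (at t)"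
      by (rule has_derivative_compose[OF _ f']) (auto intro!: derivative_eq_intros)
    then show ?thesis
      using linear_scale[OF has_derivative_linear[OF f']]
      by (simp add: has_field_derivative_def mult_commute_abs)
  qed
  define g where "g s = f (x + h *\<^sub>R v + s *\<^sub>R u) - f (x + s *\<^sub>R u)" for s
  have "(g has_real_derivative f' (x + h *\<^sub>R v + s *\<^sub>R u) u - f' (x + s *\<^sub>R u) u) (at s)" for s
    unfolding g_def by (intro DERIV_diff df)
  from MVT2[OF h this] obtain s where s: "0 < s" "s < h"
    "g h - g 0 = (h - 0) * (f' (x + h *\<^sub>R v + s *\<^sub>R u) u - f' (x + s *\<^sub>R u) u)"
    by blast
  obtain t where t: "0 < t" "t < h"
    "f' (x + s *\<^sub>R u + h *\<^sub>R v) u - f' (x + s *\<^sub>R u + 0 *\<^sub>R v) u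
      = (h - 0) * f'' (x + s *\<^sub>R u + t *\<^sub>R v) v"
    using MVT2[OF h df'[of "x + s *\<^sub>R u"]] by blast
  have "g h - g 0 = h\<^sup>2 * f'' (x + s *\<^sub>R u + t *\<^sub>R v) v"
    using s(3) t(3) by (simp add: power2_eq_square algebra_simps)
  then show ?thesis
    using s t by (intro exI[of _ s] exI[of _ t]) (simp add: g_def algebra_simps)
qed

text \<open>Both mixed derivatives are limits of the same second difference quotients.\<close>

lemma second_derivative_symmetric:
  fixes f :: "'a::real_normed_vector \<Rightarrow> real"
  assumes f: "\<And>y. (f has_derivative f' y) (at y)"
    and f'u: "\<And>y. ((\<lambda>y. f' y u) has_derivative fu y) (at y)"
    and f'v: "\<And>y. ((\<lambda>y. f' y v) has_derivative fv y) (at y)"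
    and cu: "isCont (\<lambda>y. fu y v) x" and cv: "isCont (\<lambda>y. fv y u) x"
  shows "fu x v = fv x u"
proof -
  define h :: "nat \<Rightarrow> real" where "h n = inverse (real (Suc n))" for n
  have h: "h n > 0" for n unfolding h_def by simp
  have h0: "h \<longlonglongrightarrow> 0" unfolding h_def by (rule LIMSEQ_inverse_real_of_nat)
  have "\<exists>s t s' t'. 0 < s \<and> s < h n \<and> 0 < t \<and> t < h n \<and> 0 < s' \<and> s' < h n \<and> 0 < t' \<and> t' < h n \<and>
      fu (x + s *\<^sub>R u + t *\<^sub>R v) v = fv (x + s' *\<^sub>R v + t' *\<^sub>R u) u" for n
  proof -
    obtain s t where 1: "0 < s" "s < h n" "0 < t" "t < h n"
      "f (x + h n *\<^sub>R u + h n *\<^sub>R v) - f (x + h n *\<^sub>R u) - f (x + h n *\<^sub>R v) + f x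
        = (h n)\<^sup>2 * fu (x + s *\<^sub>R u + t *\<^sub>R v) v"
      using second_difference_mean_value[OF f f'u h] by blast
    obtain s' t' where 2: "0 < s'" "s' < h n" "0 < t'" "t' < h n"
      "f (x + h n *\<^sub>R v + h n *\<^sub>R u) - f (x + h n *\<^sub>R v) - f (x + h n *\<^sub>R u) + f x
        = (h n)\<^sup>2 * fv (x + s' *\<^sub>R v + t' *\<^sub>R u) u"
      using second_difference_mean_value[OF f f'v h] by blast
    have "(h n)\<^sup>2 * fu (x + s *\<^sub>R u + t *\<^sub>R v) v = (h n)\<^sup>2 * fv (x + s' *\<^sub>R v + t' *\<^sub>R u) u"
      unfolding 1(5)[symmetric] 2(5)[symmetric] by (simp add: algebra_simps)
    then show ?thesis using 1 2 h[of n] by auto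
  qed
  then obtain s t s' t' where st:
    "\<And>n. 0 < s n \<and> s n < h n \<and> 0 < t n \<and> t n < h n \<and> 0 < s' n \<and> s' n < h n \<and> 0 < t' n \<and> t' n < h n"
    and eq: "\<And>n. fu (x + s n *\<^sub>R u + t n *\<^sub>R v) v = fv (x + s' n *\<^sub>R v + t' n *\<^sub>R u) u"
    by metis
  have lim0: "r \<longlonglongrightarrow> 0" if "\<And>n. 0 < r n \<and> r n < h n" for r
    by (rule tendsto_sandwich[OF _ _ tendsto_const h0]) 
      (use that in \<open>auto intro!: always_eventually less_imp_le\<close>)
  have lim: "(\<lambda>n. x + p n *\<^sub>R y + q n *\<^sub>R z) \<longlonglongrightarrow> x"
    if "\<And>n. 0 < p n \<and> p n < h n" "\<And>n. 0 < q n \<and> q n < h n" for p q y z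
  proof -
    have "(\<lambda>n. x + p n *\<^sub>R y + q n *\<^sub>R z) \<longlonglongrightarrow> x + 0 *\<^sub>R y + 0 *\<^sub>R z"
      by (intro tendsto_intros lim0 that)
    then show ?thesis by simp
  qed
  have "(\<lambda>n. fu (x + s n *\<^sub>R u + t n *\<^sub>R v) v) \<longlonglongrightarrow> fu x v"
    by (rule isCont_tendsto_compose[OF cu lim]) (use st in auto)
  moreover have "(\<lambda>n. fv (x + s' n *\<^sub>R v + t' n *\<^sub>R u) u) \<longlonglongrightarrow> fv x u"
    by (rule isCont_tendsto_compose[OF cv lim]) (use st in auto)
  ultimately show ?thesis
    unfolding eq by (rule LIMSEQ_unique)
qed

lemma smooth_on_imp_differentiable:
  "smooth_on S f \<Longrightarrow> x \<in> S \<Longrightarrow> f differentiable (at x)"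
  unfolding smooth_on_def by (metis times_differentiable_on.simps(2))

lemma smooth_on_frechet_derivative:
  "smooth_on S f \<Longrightarrow> smooth_on S (\<lambda>x. frechet_derivative f (at x) v)"
  unfolding smooth_on_def by (metis times_differentiable_on.simps(2))

lemma smooth_on_imp_continuous_on: "smooth_on S f \<Longrightarrow> continuous_on S f"
  unfolding smooth_on_def by (metis times_differentiable_on.simps(1))

lemma smooth_second_derivative_symmetric:
  fixes H :: "'a::real_normed_vector \<Rightarrow> real"
  assumes H: "smooth_on UNIV H"
  shows "frechet_derivative (\<lambda>y. frechet_derivative H (at y) u) (at x) v =
         frechet_derivative (\<lambda>y. frechet_derivative H (at y) v) (at x) u"
proof -
  note H' = smooth_on_frechet_derivative[OF H]
  have D: "(H has_derivative frechet_derivative H (at y)) (at y)" for y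
    using smooth_on_imp_differentiable[OF H] by (simp add: frechet_derivative_works[symmetric])
  have D2: "((\<lambda>y. frechet_derivative H (at y) w) has_derivative
      frechet_derivative (\<lambda>y. frechet_derivative H (at y) w) (at y)) (at y)" for w y
    using smooth_on_imp_differentiable[OF H'] by (simp add: frechet_derivative_works[symmetric])
  have C: "isCont (\<lambda>y. frechet_derivative (\<lambda>y. frechet_derivative H (at y) w) (at y) w') x" for w w'
    using smooth_on_imp_continuous_on[OF smooth_on_frechet_derivative[OF H']]
    by (simp add: continuous_on_eq_continuous_at)
  show ?thesis
    by (rule second_derivative_symmetric[where f = H and f' = "\<lambda>y. frechet_derivative H (at y)"
      and fu = "\<lambda>y. frechet_derivative (\<lambda>y. frechet_derivative H (at y) u) (at y)"
      and fv = "\<lambda>y. frechet_derivative (\<lambda>y. frechet_derivative H (at y) v) (at y)"])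
      (rule D D2 C)+
qed

section \<open>The algebra of symplectic Runge--Kutta methods\<close>

text \<open>The linear relations between the variations are available only modulo the kernel of \<open>\<omega>\<close>,
  hence their form as relations between values of \<open>\<omega>\<close>. The terms of first order in \<open>dt\<close> turn into
  terms of second order once the stage variations are brought in, and symplecticity of the method
  is the condition that all terms of second order cancel.\<close>

lemma symplectic_RK_preserves_form:
  fixes \<omega> :: "'a \<Rightarrow> 'b \<Rightarrow> real"
  assumes ab: "symplectic_RK a b"
    and U: "\<And>i v. \<omega> (U i) v = \<omega> u0 v + dt * (\<Sum>j\<in>UNIV. a $ i $ j * \<omega> (f j) v)"
    and u1: "\<And>v. \<omega> u1 v = \<omega> u0 v + dt * (\<Sum>j\<in>UNIV. b $ j * \<omega> (f j) v)"
    and V: "\<And>i u. \<omega> u (V i) = \<omega> u v0 + dt * (\<Sum>j\<in>UNIV. a $ i $ j * \<omega> u (g j))"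
    and v1: "\<And>u. \<omega> u v1 = \<omega> u v0 + dt * (\<Sum>j\<in>UNIV. b $ j * \<omega> u (g j))"
    and stages: "\<And>i. \<omega> (U i) (g i) + \<omega> (f i) (V i) = 0"
  shows "\<omega> u1 v1 = \<omega> u0 v0"
proof -
  let ?w = "\<lambda>i j. \<omega> (f i) (g j)"
  let ?A = "\<Sum>i\<in>UNIV. \<Sum>j\<in>UNIV. b $ j * a $ j $ i * ?w i j"
  let ?B = "\<Sum>i\<in>UNIV. \<Sum>j\<in>UNIV. b $ i * a $ i $ j * ?w i j"
  let ?C = "\<Sum>i\<in>UNIV. b $ i * (\<omega> u0 (g i) + \<omega> (f i) v0)"
  let ?D = "\<Sum>i\<in>UNIV. \<Sum>j\<in>UNIV. b $ i * b $ j * ?w i j"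
  have "\<omega> u1 v1 = \<omega> u0 v1 + dt * (\<Sum>i\<in>UNIV. b $ i * \<omega> (f i) v1)"
    by (rule u1)
  also have "\<dots> = \<omega> u0 v0 + dt * ?C + dt\<^sup>2 * ?D"
    unfolding v1 by (simp add: sum.distrib sum_distrib_left algebra_simps power2_eq_square)
  also have "?C = - dt * (?A + ?B)"
  proof -
    \<comment> \<open>the variations of the initial value are replaced by those of the stages\<close>
    have E: "\<omega> u0 (g i) + \<omega> (f i) v0 =
        - dt * ((\<Sum>j\<in>UNIV. a $ i $ j * ?w j i) + (\<Sum>j\<in>UNIV. a $ i $ j * ?w i j))" for i
      using stages[of i] U[of i "g i"] V[of "f i" i] by (simp add: algebra_simps)
    have "?C = - dt * ((\<Sum>i\<in>UNIV. \<Sum>j\<in>UNIV. b $ i * a $ i $ j * ?w j i) + ?B)"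
      unfolding E
      by (simp add: sum.distrib sum_distrib_left algebra_simps sum_negf sum_subtractf)
    also have "(\<Sum>i\<in>UNIV. \<Sum>j\<in>UNIV. b $ i * a $ i $ j * ?w j i) = ?A"
      by (rule sum.swap)
    finally show ?thesis .
  qed
  also have "?D = ?A + ?B"
  proof -
    have "b $ i * b $ j = b $ j * a $ j $ i + b $ i * a $ i $ j" for i j
      using ab unfolding symplectic_RK_def by (simp add: algebra_simps)
    then show ?thesis by (simp add: sum.distrib distrib_right)
  qed
  finally show ?thesis by (simp add: power2_eq_square)
qed

lemma inner_skew_matrix:
  fixes J :: "real^'m::finite^'m"
  assumes "transpose J = - J"
  shows "u \<bullet> (J *v v) = - (v \<bullet> (J *v u))"
proof -
  have "u \<bullet> (J *v v) = (transpose J *v u) \<bullet> v"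
    by (metis dot_lmul_matrix vector_transpose_matrix transpose_transpose)
  also have "\<dots> = - (v \<bullet> (J *v u))"
    unfolding assms by (simp add: inner_commute matrix_vector_mult_def inner_vec_def sum_negf)
  finally show ?thesis .
qed

lemma half_dz_wedge_J_dz:
  fixes J :: "real^'m::finite^'m"
  assumes "transpose J = - J"
  shows "1 / 2 * dz_wedge_J_dz J z u v = u \<bullet> (J *v v)"
proof -
  have *: "x \<bullet> (J *v y) = (\<Sum>i\<in>UNIV. \<Sum>j\<in>UNIV. J $ i $ j * (x $ i * y $ j))" for x y
    by (simp add: inner_vec_def matrix_vector_mult_def sum_distrib_left algebra_simps)
  have "dz_wedge_J_dz J z u v = u \<bullet> (J *v v) - v \<bullet> (J *v u)"
    unfolding * dz_wedge_J_dz_def wedge_def dz_def sum_subtractf[symmetric]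
    by (simp add: algebra_simps)
  then show ?thesis
    using inner_skew_matrix[OF assms, of v u] by simp
qed

section \<open>Variations of Runge--Kutta solutions\<close>

text \<open>The equations for the stages and for the final value have the same shape, with the
  coefficients \<open>c\<close> a row of \<open>a\<close> or the vector \<open>b\<close>.\<close>

lemma RK_equation_linearised:
  fixes J :: "real^'m::finite^'n::finite" and F :: "'s::finite \<Rightarrow> 'e::real_normed_vector \<Rightarrow> real^'m"
  assumes S: "open S" "x \<in> S"
    and eq: "\<And>y. y \<in> S \<Longrightarrow> J *v z y = J *v z0 y + dt *\<^sub>R (\<Sum>j\<in>UNIV. c j *\<^sub>R (J *v F j y))"
    and z: "(z has_derivative z') (at x)" and z0: "(z0 has_derivative z0') (at x)"
    and F: "\<And>j. (F j has_derivative F' j) (at x)"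
  shows "J *v z' \<xi> = J *v z0' \<xi> + dt *\<^sub>R (\<Sum>j\<in>UNIV. c j *\<^sub>R (J *v F' j \<xi>))"
proof -
  note J = bounded_linear.has_derivative[OF matrix_vector_mul_bounded_linear[of J]]
  have "((\<lambda>y. J *v z0 y + dt *\<^sub>R (\<Sum>j\<in>UNIV. c j *\<^sub>R (J *v F j y))) has_derivative
      (\<lambda>\<xi>. J *v z0' \<xi> + dt *\<^sub>R (\<Sum>j\<in>UNIV. c j *\<^sub>R (J *v F' j \<xi>)))) (at x)"
    by (intro has_derivative_add has_derivative_scaleR_right has_derivative_sum J z0 F)
  then have "((\<lambda>y. J *v z y) has_derivative
      (\<lambda>\<xi>. J *v z0' \<xi> + dt *\<^sub>R (\<Sum>j\<in>UNIV. c j *\<^sub>R (J *v F' j \<xi>)))) (at x)"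
    by (rule has_derivative_transform_within_open[OF _ S]) (simp add: eq)
  from has_derivative_unique[OF J[OF z] this] show ?thesis
    by metis
qed

text \<open>Differentiating the gradient equation identifies the left-hand side with
  \<open>D\<^sup>2 H (Z' \<xi>, Z' \<eta>)\<close> at \<open>Z x\<close>, which is symmetric.\<close>

lemma stage_variation_symmetric:
  fixes J :: "real^'n::finite^'m::finite" and Z :: "'e::real_normed_vector \<Rightarrow> real^'m"
  assumes H: "smooth_on UNIV H" and S: "open S" "x \<in> S"
    and eq: "\<And>y. y \<in> S \<Longrightarrow> GDERIV H (Z y) :> (J *v F y)"
    and Z: "(Z has_derivative Z') (at x)" and F: "(F has_derivative F') (at x)"
  shows "Z' \<xi> \<bullet> (J *v F' \<eta>) = Z' \<eta> \<bullet> (J *v F' \<xi>)"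
proof -
  let ?D = "\<lambda>w y. frechet_derivative H (at y) w"
  have hess: "w \<bullet> (J *v F' \<zeta>) = frechet_derivative (?D w) (at (Z x)) (Z' \<zeta>)" for w \<zeta>
  proof -
    have "(?D w has_derivative frechet_derivative (?D w) (at (Z x))) (at (Z x))"
      using smooth_on_imp_differentiable[OF smooth_on_frechet_derivative[OF H]]
      by (simp add: frechet_derivative_works[symmetric])
    from has_derivative_compose[OF Z this]
    have "((\<lambda>y. w \<bullet> (J *v F y)) has_derivative
        (\<lambda>\<zeta>. frechet_derivative (?D w) (at (Z x)) (Z' \<zeta>))) (at x)"
    proof (rule has_derivative_transform_within_open[OF _ S])
      fix y assume "y \<in> S"
      then show "?D w (Z y) = w \<bullet> (J *v F y)"
        using frechet_derivative_at[OF eq[unfolded gderiv_def]] by metis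
    qed
    moreover have "((\<lambda>y. w \<bullet> (J *v F y)) has_derivative (\<lambda>\<zeta>. w \<bullet> (J *v F' \<zeta>))) (at x)"
      by (intro has_derivative_inner_right
          bounded_linear.has_derivative[OF matrix_vector_mul_bounded_linear] F)
    ultimately show ?thesis
      by (metis has_derivative_unique)
  qed
  show ?thesis
    unfolding hess by (rule smooth_second_derivative_symmetric[OF H])
qed

theorem proposition3:
  fixes J :: "real^'m::finite^'m"
    and H :: "real^'m \<Rightarrow> real"
    and a :: "real^'s::finite^'s" and b :: "real^'s"
    and dt :: real
    and N :: "'p topology" and A :: "('p, 'e::real_normed_vector) chart set"
    and z0 z1 :: "'p \<Rightarrow> real^'m"
    and Z F :: "'s \<Rightarrow> 'p \<Rightarrow> real^'m"
  assumes "transpose J = - J"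
    and "smooth_on UNIV H"
    and "symplectic_RK a b"
    and "smooth_manifold N A"
    and "smooth_map A z0" and "smooth_map A z1"
    and "\<And>i. smooth_map A (Z i)" and "\<And>i. smooth_map A (F i)"
    and "\<And>p. p \<in> topspace N \<Longrightarrow>
           RK_solution J H a b dt (z0 p) (\<lambda>i. Z i p) (\<lambda>i. F i p) (z1 p)"
  shows "\<forall>p\<in>topspace N. \<forall>X\<in>tangent_space A p. \<forall>Y\<in>tangent_space A p.
           pullback A z1 (\<lambda>z u v. 1 / 2 * dz_wedge_J_dz J z u v) p X Y =
           pullback A z0 (\<lambda>z u v. 1 / 2 * dz_wedge_J_dz J z u v) p X Y"
proof (intro ballI)
  fix p X Y
  assume p: "p \<in> topspace N"
  note skew = inner_skew_matrix[OF assms(1)]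
  \<comment> \<open>the chart by which \<open>differential\<close> is defined, so that all differentials at \<open>p\<close> are
    derivatives in the same coordinates\<close>
  define c where "c = (SOME c. c \<in> A \<and> p \<in> fst c)"
  have "\<exists>c. c \<in> A \<and> p \<in> fst c"
    using assms(4) p unfolding smooth_manifold_def by blast
  from someI_ex[OF this] have c: "c \<in> A" "p \<in> fst c"
    unfolding c_def by auto
  define S where "S = snd c ` fst c"
  define x where "x = snd c p"
  have chart: "is_chart N c"
    using assms(4) c unfolding smooth_manifold_def by auto
  then have S: "open S" "x \<in> S" and sub: "fst c \<subseteq> topspace N"
    using c unfolding is_chart_def S_def x_def by (auto dest: openin_subset)
  have "inj_on (snd c) (fst c)"
    using chart sub unfolding is_chart_def homeomorphic_eq_everything_map
    by (auto simp: topspace_subtopology Int_absorb1)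
  then have inv: "chart_inv c (snd c q) = q" if "q \<in> fst c" for q
    unfolding chart_inv_def using that by (simp add: the_inv_into_f_f)
  have "chart_inv c y \<in> topspace N" if "y \<in> S" for y
    using that sub inv unfolding S_def by auto
  then have sol: "RK_solution J H a b dt ((z0 \<circ> chart_inv c) y)
      (\<lambda>i. (Z i \<circ> chart_inv c) y) (\<lambda>i. (F i \<circ> chart_inv c) y) ((z1 \<circ> chart_inv c) y)"
    if "y \<in> S" for y
    using assms(9) that by simp
  define d where "d f = frechet_derivative (f \<circ> chart_inv c) (at x)" for f :: "'p \<Rightarrow> real^'m"
  have differential: "differential A f p W = d f (W c)" for f :: "'p \<Rightarrow> real^'m" and W
    unfolding differential_def d_def x_def c_def Let_def ..
  have d: "((f \<circ> chart_inv c) has_derivative d f) (at x)" if "smooth_map A f"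
    for f :: "'p \<Rightarrow> real^'m"
    using that c S(2) smooth_on_imp_differentiable
    unfolding smooth_map_def d_def S_def frechet_derivative_works[symmetric] by blast
  have stage: "J *v d (Z i) \<xi> = J *v d z0 \<xi> + dt *\<^sub>R (\<Sum>j\<in>UNIV. a $ i $ j *\<^sub>R (J *v d (F j) \<xi>))"
    for i \<xi>
    by (rule RK_equation_linearised[OF S _ d d d, OF _ assms(7) assms(5) assms(8)])
      (use sol in \<open>auto simp: RK_solution_def\<close>)
  have final: "J *v d z1 \<xi> = J *v d z0 \<xi> + dt *\<^sub>R (\<Sum>j\<in>UNIV. b $ j *\<^sub>R (J *v d (F j) \<xi>))" for \<xi>
    by (rule RK_equation_linearised[OF S _ d d d, OF _ assms(6) assms(5) assms(8)])
      (use sol in \<open>auto simp: RK_solution_def\<close>)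
  have sym: "d (Z i) \<xi> \<bullet> (J *v d (F i) \<eta>) = d (Z i) \<eta> \<bullet> (J *v d (F i) \<xi>)" for i \<xi> \<eta>
    by (rule stage_variation_symmetric[OF assms(2) S _ d d, OF _ assms(7) assms(8)])
      (use sol in \<open>auto simp: RK_solution_def\<close>)
  have "d z1 \<xi> \<bullet> (J *v d z1 \<eta>) = d z0 \<xi> \<bullet> (J *v d z0 \<eta>)" for \<xi> \<eta>
  proof (rule symplectic_RK_preserves_form[OF assms(3),
        where \<omega> = "\<lambda>u v. u \<bullet> (J *v v)" and dt = dt
        and U = "\<lambda>i. d (Z i) \<xi>" and f = "\<lambda>i. d (F i) \<xi>"
        and V = "\<lambda>i. d (Z i) \<eta>" and g = "\<lambda>i. d (F i) \<eta>"])
    show "d (Z i) \<xi> \<bullet> (J *v v) = d z0 \<xi> \<bullet> (J *v v) +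
        dt * (\<Sum>j\<in>UNIV. a $ i $ j * (d (F j) \<xi> \<bullet> (J *v v)))" for i v
      unfolding skew[of _ v] stage by (simp add: inner_add_right inner_sum_right sum_negf)
    show "d z1 \<xi> \<bullet> (J *v v) = d z0 \<xi> \<bullet> (J *v v) +
        dt * (\<Sum>j\<in>UNIV. b $ j * (d (F j) \<xi> \<bullet> (J *v v)))" for v
      unfolding skew[of _ v] final by (simp add: inner_add_right inner_sum_right sum_negf)
    show "u \<bullet> (J *v d (Z i) \<eta>) = u \<bullet> (J *v d z0 \<eta>) +
        dt * (\<Sum>j\<in>UNIV. a $ i $ j * (u \<bullet> (J *v d (F j) \<eta>)))" for i u
      unfolding stage by (simp add: inner_add_right inner_sum_right)
    show "u \<bullet> (J *v d z1 \<eta>) = u \<bullet> (J *v d z0 \<eta>) +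
        dt * (\<Sum>j\<in>UNIV. b $ j * (u \<bullet> (J *v d (F j) \<eta>)))" for u
      unfolding final by (simp add: inner_add_right inner_sum_right)
    show "d (Z i) \<xi> \<bullet> (J *v d (F i) \<eta>) + d (F i) \<xi> \<bullet> (J *v d (Z i) \<eta>) = 0" for i
      using sym[of i \<xi> \<eta>] skew[of "d (F i) \<xi>"] by simp
  qed
  then show "pullback A z1 (\<lambda>z u v. 1 / 2 * dz_wedge_J_dz J z u v) p X Y =
      pullback A z0 (\<lambda>z u v. 1 / 2 * dz_wedge_J_dz J z u v) p X Y"
    unfolding pullback_def half_dz_wedge_J_dz[OF assms(1)] differential .
qed

end
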